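(* Let $K\ge 1$ and consider the binary-symmetric parallel-relay (BSPR) network with $K$ relays and cross-over probabilities $p_{s,i},p_{i,d}\in[0,\tfrac12]$, $i=1,\dots,K$. Every achievable rate $R$ of this network satisfies $R\le 1$.
   Context: **The BSPR network.** There is one source, $K$ relays $1,\dots,K$, and one destination. All channel inputs, outputs and noises are binary, and $\oplus$ is addition modulo 2. At each time $t=1,2,\dots$ the source transmits $U[t]\in\{0,1\}$ and relay $i$ receives $V_i[t]=U[t]\oplus Z_i[t]$ with $\Pr\{Z_i[t]=1\}=p_{s,i}$; relay $i$ transmits $X_i[t]\in\{0,1\}$ and the destination receives, on a separate link for each $i$, $Y_i[t]=X_i[t]\oplus E_i[t]$ with $\Pr\{E_i[t]=1\}=p_{i,d}$. Here $0\le p_{s,i},p_{i,d}\le \tfrac12$. All the noises $Z_i[t],E_i[t]$ (over all $i,t$) are independent of each other and of the message. **Codes and achievable rates.** A code of rate $R\ge 0$ and length $n$ has a message $W$ uniform on $\{0,1,\dots,\lceil 2^{nR}\rceil-1\}$, a source encoder giving $(U[1],\dots,U[n])$ as a function of $W$, for each relay $i$ and time $t\le n$ a function giving $X_i[t]$ from $(V_i[1],\dots,V_i[t-1])$, and a decoder giving $\hat W$ from $(Y_i[t])_{1\le i\le K,\,1\le t\le n}$. Its error probability is $P_e=\Pr\{\hat W\ne W\}$. A rate $R$ is achievable if for every $\epsilon>0$ and all sufficiently large $n$ there is a code of rate $R$ and length $n$ with $P_e<\epsilon$. Rates are in bits per channel use. *)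

theory Defs
  imports "HOL-Probability.Probability" "HOL-Library.Z2"
begin

text \<open>
  Binary symbols have type \<^typ>\<open>bit\<close>, on which \<open>+\<close> is addition modulo 2. Relays are indexed by
  \<open>{1..K}\<close> and channel uses by \<open>{1..n}\<close>; \<open>ps i\<close> and \<open>pd i\<close> are the cross-over probabilities of the
  links source--relay \<open>i\<close> and relay \<open>i\<close>--destination.
\<close>

definition messages :: "real \<Rightarrow> nat \<Rightarrow> nat set" where
  "messages R n = {0..<nat \<lceil>2 powr (real n * R)\<rceil>}"

text \<open>
  \<open>src_enc w t\<close> is the source symbol at time \<open>t\<close> for message \<open>w\<close>. \<open>relay_enc i t\<close> is applied to the
  list \<open>[V\<^sub>i[1], \<dots>, V\<^sub>i[t-1]]\<close> (so \<open>relay_enc i 1\<close> only ever sees the empty list), and \<open>decoder\<close> to the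
  list, over the relays, of the lists \<open>[Y\<^sub>i[1], \<dots>, Y\<^sub>i[n]]\<close>. Passing exactly these lists enforces
  causality at the relays.
\<close>

record code =
  src_enc :: "nat \<Rightarrow> nat \<Rightarrow> bit"
  relay_enc :: "nat \<Rightarrow> nat \<Rightarrow> bit list \<Rightarrow> bit"
  decoder :: "bit list list \<Rightarrow> nat"

definition noise_pmf :: "nat \<Rightarrow> nat \<Rightarrow> (nat \<Rightarrow> real) \<Rightarrow> (nat \<times> nat \<Rightarrow> bit) pmf" where
  "noise_pmf K n p =
     Pi_pmf ({1..K} \<times> {1..n}) 0 (\<lambda>(i, t). map_pmf of_bool (bernoulli_pmf (p i)))"

definition network_pmf ::
  "nat \<Rightarrow> (nat \<Rightarrow> real) \<Rightarrow> (nat \<Rightarrow> real) \<Rightarrow> real \<Rightarrow> nat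
    \<Rightarrow> (nat \<times> (nat \<times> nat \<Rightarrow> bit) \<times> (nat \<times> nat \<Rightarrow> bit)) pmf" where
  "network_pmf K ps pd R n =
     pair_pmf (pmf_of_set (messages R n)) (pair_pmf (noise_pmf K n ps) (noise_pmf K n pd))"

definition relay_rcv :: "code \<Rightarrow> nat \<Rightarrow> (nat \<times> nat \<Rightarrow> bit) \<Rightarrow> nat \<Rightarrow> nat \<Rightarrow> bit" where
  "relay_rcv c w z i t = src_enc c w t + z (i, t)"

definition relay_snd :: "code \<Rightarrow> nat \<Rightarrow> (nat \<times> nat \<Rightarrow> bit) \<Rightarrow> nat \<Rightarrow> nat \<Rightarrow> bit" where
  "relay_snd c w z i t = relay_enc c i t (map (relay_rcv c w z i) [1..<t])"

definition dest_rcv ::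
  "code \<Rightarrow> nat \<Rightarrow> (nat \<times> nat \<Rightarrow> bit) \<Rightarrow> (nat \<times> nat \<Rightarrow> bit) \<Rightarrow> nat \<Rightarrow> nat \<Rightarrow> bit" where
  "dest_rcv c w z e i t = relay_snd c w z i t + e (i, t)"

definition decoded ::
  "nat \<Rightarrow> nat \<Rightarrow> code \<Rightarrow> nat \<Rightarrow> (nat \<times> nat \<Rightarrow> bit) \<Rightarrow> (nat \<times> nat \<Rightarrow> bit) \<Rightarrow> nat" where
  "decoded K n c w z e = decoder c (map (\<lambda>i. map (dest_rcv c w z e i) [1..<Suc n]) [1..<Suc K])"

definition error_prob ::
  "nat \<Rightarrow> (nat \<Rightarrow> real) \<Rightarrow> (nat \<Rightarrow> real) \<Rightarrow> real \<Rightarrow> nat \<Rightarrow> code \<Rightarrow> real" where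
  "error_prob K ps pd R n c =
     measure_pmf.prob (network_pmf K ps pd R n) {(w, z, e). decoded K n c w z e \<noteq> w}"

definition achievable :: "nat \<Rightarrow> (nat \<Rightarrow> real) \<Rightarrow> (nat \<Rightarrow> real) \<Rightarrow> real \<Rightarrow> bool" where
  "achievable K ps pd R \<longleftrightarrow>
     0 \<le> R \<and> (\<forall>\<epsilon>>0. \<forall>\<^sub>F n in sequentially. \<exists>c. error_prob K ps pd R n c < \<epsilon>)"

end

theory Submission
  imports Defs
begin

text \<open>
  Whatever the relays and the noises do, the destination depends on the message only through the
  source word, and there are only \<open>2 ^ n\<close> source words of length \<open>n\<close>. Hence for every fixed noise
  at most \<open>2 ^ n\<close> messages are decoded correctly, so the probability of correct decoding is at most
  \<open>2 powr (n * (1 - R))\<close>, which tends to \<open>0\<close> if \<open>R > 1\<close>.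
\<close>

text \<open>With \<open>z\<close> and \<open>e\<close> fixed, a relay acting at time t \<le> n reads
  source symbols from times before t only, so the whole chain up to the decoder is a function of the
  first \<open>n\<close> source symbols.\<close>

lemma decoded_cong:
  assumes "map (src_enc c w) [1..<Suc n] = map (src_enc c w') [1..<Suc n]"
  shows "decoded K n c w z e = decoded K n c w' z e"
proof -
  have src: "src_enc c w t = src_enc c w' t" if "t \<in> {1..<Suc n}" for t
    using assms that by (simp only: map_eq_conv set_upt)
  have "map (relay_rcv c w z i) [1..<t] = map (relay_rcv c w' z i) [1..<t]"
    if "t \<in> {1..<Suc n}" for i t
    using that by (auto simp: relay_rcv_def src)
  then have "dest_rcv c w z e i t = dest_rcv c w' z e i t" if "t \<in> {1..<Suc n}" for i t
    unfolding dest_rcv_def relay_snd_def using that by metis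
  then have "map (dest_rcv c w z e i) [1..<Suc n] = map (dest_rcv c w' z e i) [1..<Suc n]" for i
    by (simp only: map_eq_conv set_upt) blast
  then show ?thesis
    by (simp only: decoded_def)
qed

text \<open>Two correctly decoded messages with the same source word are both equal to the common
  decoder output, so encoding is injective on these messages.\<close>

lemma card_correctly_decoded_le: "card {w \<in> A. decoded K n c w z e = w} \<le> 2 ^ n"
proof -
  \<comment> \<open>Words over the alphabet \<open>{0, 1}\<close>, in the form counted by
    \<open>card_lists_length_eq\<close>.\<close>
  define words where "words = {xs :: bit list. set xs \<subseteq> {0, 1} \<and> length xs = n}"
  have words: "finite words" "card words = 2 ^ n"
    by (simp_all add: words_def finite_lists_length_eq card_lists_length_eq numeral_2_eq_2)
  have "inj_on (\<lambda>w. map (src_enc c w) [1..<Suc n]) {w \<in> A. decoded K n c w z e = w}"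
  proof (rule inj_onI)
    fix w w'
    assume w: "w \<in> {w \<in> A. decoded K n c w z e = w}" "w' \<in> {w \<in> A. decoded K n c w z e = w}"
      and "map (src_enc c w) [1..<Suc n] = map (src_enc c w') [1..<Suc n]"
    then have "decoded K n c w z e = decoded K n c w' z e"
      by (intro decoded_cong)
    with w show "w = w'"
      by simp
  qed
  moreover have "(\<lambda>w. map (src_enc c w) [1..<Suc n]) ` {w \<in> A. decoded K n c w z e = w} \<subseteq> words"
    by (auto simp: words_def simp del: upt_Suc)
  ultimately show ?thesis
    unfolding words(2)[symmetric] using words(1) by (rule card_inj_on_le)
qed

text \<open>By independence the probability of \<open>S\<close> is the average over \<open>y\<close>
  of the probabilities of its sections; this lets the noise be fixed first.\<close>

lemma prob_pair_pmf_le: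
  fixes p :: "'a pmf" and q :: "'b pmf"
  assumes "\<And>y. measure_pmf.prob p {x. (x, y) \<in> S} \<le> b"
  shows "measure_pmf.prob (pair_pmf p q) S \<le> b"
proof -
  have b: "0 \<le> b"
    using assms measure_nonneg order_trans by blast
  \<comment> \<open>\<open>pair_pmf\<close> draws the first component first; swapping the draws
    exposes the sections at fixed \<open>y\<close>.\<close>
  have "pair_pmf p q = bind_pmf q (\<lambda>y. map_pmf (\<lambda>x. (x, y)) p)"
    unfolding pair_pmf_def map_pmf_def by (rule bind_commute_pmf)
  then have "emeasure (pair_pmf p q) S = (\<integral>\<^sup>+y. emeasure p {x. (x, y) \<in> S} \<partial>q)"
    by (simp add: vimage_def)
  also have "\<dots> \<le> (\<integral>\<^sup>+y. ennreal b \<partial>q)"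
    by (intro nn_integral_mono) (simp add: measure_pmf.emeasure_eq_measure assms b)
  finally show ?thesis
    by (simp add: measure_pmf.emeasure_eq_measure b)
qed

lemma finite_messages [simp]: "finite (messages R n)"
  by (simp add: messages_def)

lemma card_messages_ge: "2 powr (real n * R) \<le> real (card (messages R n))"
  by (simp add: messages_def)

lemma messages_nonempty [simp]: "messages R n \<noteq> {}"
proof
  assume "messages R n = {}"
  then have "2 powr (real n * R) \<le> 0"
    using card_messages_ge[of n R] by simp
  then show False
    by simp
qed

lemma error_prob_ge: "1 - 2 powr (real n * (1 - R)) \<le> error_prob K ps pd R n c"
proof -
  let ?P = "network_pmf K ps pd R n"
  let ?S = "{(w, z, e). decoded K n c w z e = w}"
  have "measure_pmf.prob (pmf_of_set (messages R n)) {w. (w, y) \<in> ?S} \<le> 2 powr (real n * (1 - R))"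
    for y
  proof -
    obtain z e where y: "y = (z, e)"
      by force
    have "real (card {w \<in> messages R n. decoded K n c w z e = w}) \<le> real (2 ^ n)"
      using card_correctly_decoded_le by (rule of_nat_mono)
    also have "\<dots> = 2 powr n"
      by (simp add: powr_realpow)
    finally have "real (card {w \<in> messages R n. decoded K n c w z e = w}) \<le> 2 powr n" .
    \<comment> \<open>The message is uniform, so its success probability given the noise is this
      ratio. The ceiling in \<open>messages\<close> only enlarges the denominator.\<close>
    then have "real (card {w \<in> messages R n. decoded K n c w z e = w}) / card (messages R n)
        \<le> 2 powr n / 2 powr (real n * R)"
      using card_messages_ge by (intro frac_le) auto
    also have "\<dots> = 2 powr (real n * (1 - R))"
      by (simp add: right_diff_distrib powr_diff)
    finally show ?thesis
      by (simp add: y measure_pmf_of_set Int_def)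
  qed
  then have "measure_pmf.prob ?P ?S \<le> 2 powr (real n * (1 - R))"
    unfolding network_pmf_def by (rule prob_pair_pmf_le)
  moreover have "error_prob K ps pd R n c = measure_pmf.prob ?P (- ?S)"
    unfolding error_prob_def by (rule arg_cong[where f = "measure_pmf.prob ?P"]) auto
  then have "error_prob K ps pd R n c = 1 - measure_pmf.prob ?P ?S"
    using measure_pmf.prob_compl[of ?S ?P] by (simp add: Compl_eq_Diff_UNIV)
  ultimately show ?thesis
    by simp
qed

theorem theorem1:
  fixes K :: nat and ps pd :: "nat \<Rightarrow> real" and R :: real
  assumes "K \<ge> 1"
    and "\<And>i. i \<in> {1..K} \<Longrightarrow> 0 \<le> ps i \<and> ps i \<le> 1 / 2"
    and "\<And>i. i \<in> {1..K} \<Longrightarrow> 0 \<le> pd i \<and> pd i \<le> 1 / 2"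
    and "achievable K ps pd R"
  shows "R \<le> 1"
proof (rule ccontr)
  assume "\<not> R \<le> 1"
  then have "2 powr (1 - R) < 1"
    by (simp add: powr_less_one)
  then have "(\<lambda>n. (2 powr (1 - R)) ^ n) \<longlonglongrightarrow> 0"
    by (intro LIMSEQ_realpow_zero) simp_all
  then have "(\<lambda>n. 2 powr (real n * (1 - R))) \<longlonglongrightarrow> 0"
    by (simp add: powr_power)
  \<comment> \<open>The threshold 1/2 serves twice: success probability below 1/2 forces error above
    1/2, against a code with error below 1/2.\<close>
  then have "\<forall>\<^sub>F n in sequentially. 2 powr (real n * (1 - R)) < 1 / 2"
    by (rule order_tendstoD) simp
  moreover have "\<forall>\<epsilon>>0. \<forall>\<^sub>F n in sequentially. \<exists>c. error_prob K ps pd R n c < \<epsilon>"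
    using assms(4) unfolding achievable_def by blast
  then have "\<forall>\<^sub>F n in sequentially. \<exists>c. error_prob K ps pd R n c < 1 / 2"
    by (rule allE[where x = "1 / 2"]) simp
  ultimately have "\<forall>\<^sub>F n in sequentially. False"
  proof eventually_elim
    case (elim n)
    then obtain c where "error_prob K ps pd R n c < 1 / 2"
      by blast
    with elim(1) error_prob_ge[of n R K ps pd c] show ?case
      by simp
  qed
  then show False
    by simp
qed

end
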